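(* Let $a<b$ be real and let $\Psi\in C^1([a,b])$ be a positive increasing function with $\Psi'(x)\neq0$ for all $x\in[a,b]$. For $\nu>0$ and any $\mu,s\in\mathbb{C}$, the following relations hold for $x\in(a,b)$: $${}^{H}_{a}I^{\mu,s}_{\Psi(x)}\left\{\Psi(x)^{-s}\left(\log\frac{\Psi(x)}{\Psi(a)}\right)^{\nu-1}\right\}=\frac{\Gamma(\nu)}{\Gamma(\nu+\mu)}\,\Psi(x)^{-s}\left(\log\frac{\Psi(x)}{\Psi(a)}\right)^{\nu+\mu-1};$$ $${}^{HR}_{a}D^{\mu,s}_{\Psi(x)}\left\{\Psi(x)^{-s}\left(\log\frac{\Psi(x)}{\Psi(a)}\right)^{\nu-1}\right\}=\frac{\Gamma(\nu)}{\Gamma(\nu-\mu)}\,\Psi(x)^{-s}\left(\log\frac{\Psi(x)}{\Psi(a)}\right)^{\nu-\mu-1}.$$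
   Context: Hadamard-type operators with respect to $\Psi$ (equivalently, tempered operators with respect to $\log\circ\Psi$): for $\mathrm{Re}(\mu)>0$, $${}^{H}_{a}I^{\mu,s}_{\Psi(x)}f(x)=\frac{1}{\Gamma(\mu)}\int_{a}^{x}\left(\frac{\Psi(t)}{\Psi(x)}\right)^{s}\left(\log\frac{\Psi(x)}{\Psi(t)}\right)^{\mu-1}f(t)\frac{\Psi'(t)}{\Psi(t)}\,dt;$$ for a nonnegative integer $n$, $${}^{H}_{a}D^{n,s}_{\Psi(x)}f(x)=\Psi(x)^{-s}\left(\frac{\Psi(x)}{\Psi'(x)}\frac{d}{dx}\right)^{n}\big[\Psi(x)^{s}f(x)\big];$$ and for $\mathrm{Re}(\mu)\ge0$ with $n=\lfloor\mathrm{Re}(\mu)\rfloor+1$, ${}^{HR}_{a}D^{\mu,s}_{\Psi(x)}f={}^{H}_{a}D^{n,s}_{\Psi(x)}\,{}^{H}_{a}I^{n-\mu,s}_{\Psi(x)}f$. For the remaining values of $\mu$ the conventions are ${}^{H}_{a}I^{\mu,s}_{\Psi(x)}={}^{HR}_{a}D^{-\mu,s}_{\Psi(x)}$ for $\mathrm{Re}(\mu)\le0$ and ${}^{HR}_{a}D^{\mu,s}_{\Psi(x)}={}^{H}_{a}I^{-\mu,s}_{\Psi(x)}$ for $\mathrm{Re}(\mu)<0$. The value $1/\Gamma(z)$ is $0$ when $z$ is a nonpositive integer. *)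

theory Defs
  imports "HOL-Analysis.Analysis"
begin

text \<open>
  Operators act on functions \<open>f :: real \<Rightarrow> complex\<close>.  The integral is the Lebesgue integral over the
  open interval, so the possible singularities at both endpoints play no role.  The derivative
  \<open>\<Psi>'\<close> is rendered as \<^term>\<open>deriv \<Psi>\<close>, which is only ever evaluated at the points of
  integration and at the point where the operator is applied; for arguments inside \<open>(a, b)\<close> these
  are interior points of the domain of \<open>\<Psi>\<close>.
\<close>

definition hadamard_integral ::
  "(real \<Rightarrow> real) \<Rightarrow> real \<Rightarrow> complex \<Rightarrow> complex \<Rightarrow> (real \<Rightarrow> complex) \<Rightarrow> real \<Rightarrow> complex"
where
  "hadamard_integral \<Psi> a \<mu> s f x =
     rGamma \<mu> *
     (LINT t:{a<..<x}|lborel.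
        of_real (\<Psi> t / \<Psi> x) powr s * of_real (ln (\<Psi> x / \<Psi> t)) powr (\<mu> - 1) *
        f t * of_real (deriv \<Psi> t / \<Psi> t))"

definition Psi_log_deriv :: "(real \<Rightarrow> real) \<Rightarrow> (real \<Rightarrow> complex) \<Rightarrow> real \<Rightarrow> complex" where
  "Psi_log_deriv \<Psi> g x = of_real (\<Psi> x / deriv \<Psi> x) * vector_derivative g (at x)"

definition hadamard_deriv_nat ::
  "(real \<Rightarrow> real) \<Rightarrow> nat \<Rightarrow> complex \<Rightarrow> (real \<Rightarrow> complex) \<Rightarrow> real \<Rightarrow> complex"
where
  "hadamard_deriv_nat \<Psi> n s f x =
     of_real (\<Psi> x) powr (- s) *
     (Psi_log_deriv \<Psi> ^^ n) (\<lambda>y. of_real (\<Psi> y) powr s * f y) x"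

definition hadamard_RL_deriv ::
  "(real \<Rightarrow> real) \<Rightarrow> real \<Rightarrow> complex \<Rightarrow> complex \<Rightarrow> (real \<Rightarrow> complex) \<Rightarrow> real \<Rightarrow> complex"
where
  "hadamard_RL_deriv \<Psi> a \<mu> s f =
     (let n = nat \<lfloor>Re \<mu>\<rfloor> + 1
      in hadamard_deriv_nat \<Psi> n s (hadamard_integral \<Psi> a (of_nat n - \<mu>) s f))"

text \<open>
  The two operators above are the formulas for \<open>Re \<mu> > 0\<close> and \<open>Re \<mu> \<ge> 0\<close> respectively; the
  operators of arbitrary complex order are obtained from them by sign reversal of the order.
\<close>

definition hadamard_I ::
  "(real \<Rightarrow> real) \<Rightarrow> real \<Rightarrow> complex \<Rightarrow> complex \<Rightarrow> (real \<Rightarrow> complex) \<Rightarrow> real \<Rightarrow> complex"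
where
  "hadamard_I \<Psi> a \<mu> s f =
     (if Re \<mu> > 0 then hadamard_integral \<Psi> a \<mu> s f else hadamard_RL_deriv \<Psi> a (- \<mu>) s f)"

definition hadamard_D ::
  "(real \<Rightarrow> real) \<Rightarrow> real \<Rightarrow> complex \<Rightarrow> complex \<Rightarrow> (real \<Rightarrow> complex) \<Rightarrow> real \<Rightarrow> complex"
where
  "hadamard_D \<Psi> a \<mu> s f =
     (if Re \<mu> \<ge> 0 then hadamard_RL_deriv \<Psi> a \<mu> s f else hadamard_integral \<Psi> a (- \<mu>) s f)"

end

theory Submission imports Defs begin

text \<open>
  In the variable \<open>u = ln (\<Psi> t / \<Psi> a)\<close> the weight \<open>\<Psi>\<^sup>s\<close> conjugates both operators into the classical
  Riemann--Liouville ones, and the statement becomes the rule for their action on a power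
  \<open>u\<^bsup>\<nu> - 1\<^esup>\<close>.

  For \<open>Re \<mu> > 0\<close>, put \<open>L = ln (\<Psi> x / \<Psi> a)\<close>. The powers of \<open>\<Psi>\<close> combine to the constant
  \<open>\<Psi> x powr (- s)\<close>, and the substitution \<open>v = u / L\<close> leaves \<open>L\<^bsup>\<nu> + \<mu> - 1\<^esup>\<close> times Euler's integral of
  \<open>v\<^bsup>\<nu> - 1\<^esup> (1 - v)\<^bsup>\<mu> - 1\<^esup>\<close> over \<open>(0, 1)\<close> (\<open>hadamard_integral_log_power\<close>). That integral is needed for
  complex exponents; \<open>Beta_integral_complex\<close> obtains it by integrating the convolution of two
  Gamma kernels in both orders.

  The remaining orders \<open>\<mu> = - \<alpha>\<close> with \<open>Re \<alpha> \<ge> 0\<close> reduce to the first case: the operator is an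
  integral of order \<open>n - \<alpha>\<close>, whose real part is positive, followed by \<open>n\<close> derivatives with respect
  to \<open>u\<close>. Each derivative turns
  \<open>u\<^bsup>w - 1\<^esup> / \<Gamma>(w)\<close> into \<open>u\<^bsup>w - 2\<^esup> / \<Gamma>(w - 1)\<close> (\<open>Psi_log_deriv_funpow\<close>). Because \<open>1 / \<Gamma>\<close> is
  entire and satisfies \<open>z / \<Gamma>(z + 1) = 1 / \<Gamma>(z)\<close> everywhere, this stays correct when \<open>w - 1\<close> is a
  pole of \<open>\<Gamma>\<close>, where both sides vanish.
\<close>

section \<open>Euler's Beta integral with complex exponents\<close>

text \<open>
  The integrand of \<open>\<Gamma>\<close>, extended by zero to the whole line so that translations and products of
  such functions can be integrated against Lebesgue measure with no bookkeeping of domains.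
\<close>

definition Gamma_kernel :: "complex \<Rightarrow> real \<Rightarrow> complex" where
  "Gamma_kernel z t = indicator {0<..} t *\<^sub>R (of_real t powr (z - 1) / of_real (exp t))"

text \<open>
  The principal branch jumps across the negative axis; restricted to real arguments it is given by
  a separate elementary formula on each half-line.
\<close>
lemma powr_of_real_measurable [measurable]:
  fixes f :: "'a \<Rightarrow> real"
  assumes [measurable]: "f \<in> borel_measurable M"
  shows "(\<lambda>x. complex_of_real (f x) powr c) \<in> borel_measurable M"
proof -
  have *: "complex_of_real y powr c =
             (if y = 0 then 0 else exp (c * (of_real (ln \<bar>y\<bar>) + (if y < 0 then \<i> * of_real pi else 0))))" for y
  proof (cases "y < 0")
    case True
    then have "Ln (complex_of_real y) = of_real (ln \<bar>y\<bar>) + \<i> * of_real pi"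
      using Ln_minus[of "complex_of_real (-y)"] Ln_of_real[of "-y"] by simp
    with True show ?thesis by (simp add: powr_def)
  next
    case False
    then show ?thesis by (cases "y = 0") (auto simp: powr_def Ln_of_real)
  qed
  show ?thesis unfolding * by measurable
qed

lemma Gamma_kernel_measurable [measurable]: "Gamma_kernel z \<in> borel_measurable borel"
  unfolding Gamma_kernel_def by measurable

lemma
  assumes "Re z > 0"
  shows integrable_Gamma_kernel: "integrable lborel (Gamma_kernel z)"
    and integral_Gamma_kernel: "integral\<^sup>L lborel (Gamma_kernel z) = Gamma z"
proof -
  have ker: "Gamma_kernel z = (\<lambda>t. indicator {0<..} t *\<^sub>R (of_real t powr (z - 1) / of_real (exp t)))"
    by (simp add: Gamma_kernel_def fun_eq_iff)
  show int: "integrable lborel (Gamma_kernel z)"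
    using absolutely_integrable_Gamma_integral'[OF assms]
    unfolding set_integrable_def ker[symmetric] by (subst (asm) integrable_completion) auto
  have "integral\<^sup>L lborel (Gamma_kernel z) =
      (LINT t:{0<..}|lborel. of_real t powr (z - 1) / of_real (exp t))"
    by (simp add: set_lebesgue_integral_def ker)
  also have "\<dots> = integral {0<..} (\<lambda>t. of_real t powr (z - 1) / of_real (exp t))"
    by (rule set_borel_integral_eq_integral) (use int in \<open>simp add: set_integrable_def ker\<close>)
  also have "\<dots> = Gamma z"
    using Gamma_integral_complex'[OF assms] by (rule integral_unique)
  finally show "integral\<^sup>L lborel (Gamma_kernel z) = Gamma z" .
qed

text \<open>
  The imaginary parts of the exponents only contribute factors of modulus one, so the real Beta
  integrand is a majorant.
\<close>
lemma integrable_Beta_complex: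
  assumes "Re a > 0" "Re b > 0"
  shows "set_integrable lborel {0<..<1} (\<lambda>t. of_real t powr (a - 1) * of_real (1 - t) powr (b - 1))"
proof -
  have "set_integrable lborel {0<..<1} (\<lambda>t. t powr (Re a - 1) * (1 - t) powr (Re b - 1))"
    by (rule set_integrable_subset[OF integrable_Beta[OF assms]]) auto
  then show ?thesis
    unfolding set_integrable_def
  proof (rule Bochner_Integration.integrable_bound)
    show "AE t in lborel. norm (indicator {0<..<1} t *\<^sub>R
            (complex_of_real t powr (a - 1) * of_real (1 - t) powr (b - 1)))
          \<le> norm (indicator {0<..<1} t *\<^sub>R (t powr (Re a - 1) * (1 - t) powr (Re b - 1)))"
      by (intro AE_I2) (simp add: indicator_def norm_mult norm_powr_real_powr abs_mult
            del: of_real_diff)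
  qed measurable
qed

text \<open>
  Scaling \<open>t = u v\<close> separates the variables: the exponentials multiply to \<open>exp (- u)\<close>
  independently of \<open>v\<close>, and homogeneity pulls the power \<open>u\<^bsup>a + b - 1\<^esup>\<close> out of the integral.
\<close>
lemma integral_Gamma_kernel_convolution:
  fixes u :: real
  shows "(LINT t|lborel. Gamma_kernel a t * Gamma_kernel b (u - t)) =
         Gamma_kernel (a + b) u *
           (LINT t:{0<..<1}|lborel. of_real t powr (a - 1) * of_real (1 - t) powr (b - 1))"
proof (cases "u > 0")
  case False
  then have "Gamma_kernel a t * Gamma_kernel b (u - t) = 0" for t
    by (auto simp: Gamma_kernel_def indicator_def)
  then have "(LINT t|lborel. Gamma_kernel a t * Gamma_kernel b (u - t)) = 0"
    by (simp only: integral_zero)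
  with False show ?thesis by (simp add: Gamma_kernel_def)
next
  case True
  have "of_real u * (Gamma_kernel a (0 + u * t) * Gamma_kernel b (u - (0 + u * t))) =
          Gamma_kernel (a + b) u *
          (indicator {0<..<1} t *\<^sub>R (of_real t powr (a - 1) * of_real (1 - t) powr (b - 1)))" for t
  proof (cases "t \<in> {0<..<1}")
    case False
    with True have "\<not> (0 < u * t \<and> 0 < u - u * t)"
      by (auto simp: zero_less_mult_iff)
    with False show ?thesis by (auto simp: Gamma_kernel_def)
  next
    case t: True
    have "u - u * t > 0" "u * t > 0" using True t by auto
    moreover have "of_real (u * t) powr (a - 1) = complex_of_real u powr (a - 1) * of_real t powr (a - 1)"
      unfolding of_real_mult by (rule powr_times_real) (use True t in auto)
    moreover have "of_real (u - u * t) powr (b - 1)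
        = complex_of_real u powr (b - 1) * of_real (1 - t) powr (b - 1)"
    proof -
      have "u - u * t = u * (1 - t)" by (simp add: algebra_simps)
      then show ?thesis
        unfolding \<open>u - u * t = _\<close> of_real_mult by (intro powr_times_real) (use True t in auto)
    qed
    moreover have "complex_of_real u powr (a + b - 1) = of_real u * (of_real u powr (a - 1) * of_real u powr (b - 1))"
    proof -
      have "complex_of_real u powr (a + b - 1) = of_real u powr (1 + ((a - 1) + (b - 1)))"
        by simp
      also have "\<dots> = of_real u * (of_real u powr (a - 1) * of_real u powr (b - 1))"
        unfolding powr_add using True by simp
      finally show ?thesis .
    qed
    moreover have "exp u = exp (u * t) * exp (u - u * t)"
      by (simp flip: exp_add)
    ultimately show ?thesis using True t
      by (simp add: Gamma_kernel_def)
  qed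
  then have "(\<lambda>t. of_real u * (Gamma_kernel a (0 + u * t) * Gamma_kernel b (u - (0 + u * t)))) =
      (\<lambda>t. Gamma_kernel (a + b) u *
          (indicator {0<..<1} t *\<^sub>R (of_real t powr (a - 1) * of_real (1 - t) powr (b - 1))))" 
    by (rule ext)
  from arg_cong[OF this, of "integral\<^sup>L lborel"] show ?thesis
    using True lborel_integral_real_affine[of u "\<lambda>t. Gamma_kernel a t * Gamma_kernel b (u - t)" 0]
    by (simp add: set_lebesgue_integral_def scaleR_conv_of_real)
qed

text \<open>
  By Fubini, the double integral of \<open>Gamma_kernel a t * Gamma_kernel b (u - t)\<close> is \<open>\<Gamma>(a) \<Gamma>(b)\<close> when
  \<open>u\<close> is integrated first, and \<open>\<Gamma>(a + b)\<close> times the Beta integral when \<open>t\<close> is integrated first.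
\<close>
theorem Beta_integral_complex:
  assumes a: "Re a > 0" and b: "Re b > 0"
  shows "(LINT t:{0<..<1}|lborel. of_real t powr (a - 1) * of_real (1 - t) powr (b - 1)) = Beta a b"
    (is "?B = _")
proof -
  have shift: "integrable lborel (\<lambda>u. Gamma_kernel b (u - t))"
      "(LINT u|lborel. Gamma_kernel b (u - t)) = Gamma b"
      "(LINT u|lborel. norm (Gamma_kernel b (u - t))) = (LINT u|lborel. norm (Gamma_kernel b u))" for t
    using lborel_integrable_real_affine[OF integrable_Gamma_kernel[OF b], of 1 "-t"]
      lborel_integral_real_affine[of 1 "Gamma_kernel b" "-t"]
      lborel_integral_real_affine[of 1 "\<lambda>u. norm (Gamma_kernel b u)" "-t"]
      integral_Gamma_kernel[OF b] by simp_all
  have "integrable (lborel \<Otimes>\<^sub>M lborel) (\<lambda>(t, u). Gamma_kernel a t * Gamma_kernel b (u - t))"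
  proof (rule lborel_pair.Fubini_integrable)
    show "integrable lborel (\<lambda>t. LINT u|lborel.
        norm (case (t, u) of (t, u) \<Rightarrow> Gamma_kernel a t * Gamma_kernel b (u - t)))"
      using integrable_Gamma_kernel[OF a] by (simp add: norm_mult shift)
    show "AE t in lborel. integrable lborel
        (\<lambda>u. case (t, u) of (t, u) \<Rightarrow> Gamma_kernel a t * Gamma_kernel b (u - t))"
      using shift by simp
  qed measurable
  from lborel_pair.Fubini_integral[OF this]
  have "(LINT u|lborel. Gamma_kernel (a + b) u * ?B) =
        (LINT t|lborel. Gamma_kernel a t * Gamma b)"
    by (simp add: integral_Gamma_kernel_convolution shift)
  then have "Gamma (a + b) * ?B = Gamma a * Gamma b"
    using a b by (simp add: integral_Gamma_kernel)
  moreover have "Gamma (a + b) \<noteq> 0"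
    using a b by (auto simp: Gamma_eq_zero_iff elim!: nonpos_Ints_cases dest!: arg_cong[of _ _ Re])
  ultimately show ?thesis by (simp add: Beta_def field_simps)
qed

section \<open>Hadamard integrals of logarithmic powers\<close>

text \<open>
  The normalised logarithm \<open>g t = ln (\<Psi> t / \<Psi> a) / ln (\<Psi> x / \<Psi> a)\<close> maps \<open>(a, x)\<close> bijectively onto
  \<open>(0, 1)\<close>, and in this coordinate the integrand is a constant multiple of the Beta integrand.
\<close>
lemma hadamard_integral_log_power:
  fixes a x :: real and \<mu> \<nu> s :: complex
  assumes ax: "a < x"
    and cont: "continuous_on {a..x} \<Psi>"
    and der: "\<And>t. t \<in> {a<..<x} \<Longrightarrow> (\<Psi> has_real_derivative \<Psi>' t) (at t)"
    and der_cont: "continuous_on {a<..<x} \<Psi>'"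
    and der_pos: "\<And>t. t \<in> {a<..<x} \<Longrightarrow> \<Psi>' t > 0"
    and pos: "\<And>t. t \<in> {a..x} \<Longrightarrow> \<Psi> t > 0"
    and \<mu>: "Re \<mu> > 0" and \<nu>: "Re \<nu> > 0"
  shows "hadamard_integral \<Psi> a \<mu> s
           (\<lambda>t. of_real (\<Psi> t) powr (- s) * of_real (ln (\<Psi> t / \<Psi> a)) powr (\<nu> - 1)) x
         = Gamma \<nu> * rGamma (\<nu> + \<mu>) *
           of_real (\<Psi> x) powr (- s) * of_real (ln (\<Psi> x / \<Psi> a)) powr (\<nu> + \<mu> - 1)"
proof -
  define L where "L = ln (\<Psi> x / \<Psi> a)"
  define g where "g t = ln (\<Psi> t / \<Psi> a) / L" for t
  define f where "f v = complex_of_real v powr (\<nu> - 1) * of_real (1 - v) powr (\<mu> - 1)" for v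
  have mono: "\<Psi> t < \<Psi> t'" if "a \<le> t" "t < t'" "t' \<le> x" for t t'
    by (rule DERIV_pos_imp_increasing_open)
       (use that der der_pos in \<open>force intro: continuous_on_subset[OF cont]\<close>)+
  have L: "L > 0" unfolding L_def using mono[of a x] ax pos[of a] by (auto intro!: ln_gt_zero)
  have g_mono: "g t < g t'" if "a \<le> t" "t < t'" "t' \<le> x" for t t'
    unfolding g_def using mono[OF that] pos[of t] pos[of t'] pos[of a] L that
    by (auto intro!: divide_strict_right_mono simp: divide_simps)
  have g_cont: "continuous_on {a..x} g"
    unfolding g_def using L pos ax by (auto intro!: continuous_intros cont; force)
  have g_ends: "g a = 0" "g x = 1"
    using L pos[of a] ax by (simp_all add: g_def L_def)
  have g_der: "(g has_real_derivative \<Psi>' t / \<Psi> t / L) (at t within {a<..<x})" if "t \<in> {a<..<x}" for t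
    unfolding g_def using L pos[of a] pos[of t] that ax
    by (auto intro!: derivative_eq_intros has_field_derivative_at_within[OF der] simp: divide_simps)
  have inj: "inj_on g {a<..<x}"
    by (rule linorder_inj_onI') (use g_mono in \<open>simp add: less_imp_neq\<close>)
  have image: "g ` {a<..<x} = {0<..<1}"
  proof (intro equalityI subsetI)
    fix v assume "v \<in> g ` {a<..<x}"
    then show "v \<in> {0<..<1}" using g_mono[of a] g_mono[of _ x] g_ends by force
  next
    fix v :: real assume v: "v \<in> {0<..<1}"
    then obtain t where "t \<ge> a" "t \<le> x" "g t = v"
      using IVT'[of g a v x] g_cont g_ends ax by auto
    with v g_ends show "v \<in> g ` {a<..<x}"
      by (intro image_eqI[of _ _ t]) (auto simp: less_le)
  qed
  have f_int: "set_integrable lborel {0<..<1} f"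
    unfolding f_def by (rule integrable_Beta_complex) fact+
  have f_abs: "f absolutely_integrable_on {0<..<1}"
    using f_int unfolding set_integrable_def
    by (subst integrable_completion) (auto intro: borel_measurable_integrable)
  have f_val: "integral {0<..<1} f = Beta \<nu> \<mu>"
    using Beta_integral_complex[OF \<nu> \<mu>] set_borel_integral_eq_integral(2)[OF f_int]
    by (simp add: f_def)
  define h where "h t = \<bar>\<Psi>' t / \<Psi> t / L\<bar> *\<^sub>R f (g t)" for t
  have subst: "h absolutely_integrable_on {a<..<x} \<and> integral {a<..<x} h = Beta \<nu> \<mu>"
    unfolding h_def
    by (subst has_absolute_integral_change_of_variables_real[OF _ g_der inj])
       (use f_abs f_val in \<open>simp_all add: image\<close>)
  have integrand: "of_real (\<Psi> t / \<Psi> x) powr s * of_real (ln (\<Psi> x / \<Psi> t)) powr (\<mu> - 1) *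
        (of_real (\<Psi> t) powr (- s) * of_real (ln (\<Psi> t / \<Psi> a)) powr (\<nu> - 1)) * of_real (deriv \<Psi> t / \<Psi> t)
      = of_real (\<Psi> x) powr (- s) * of_real L powr (\<nu> + \<mu> - 1) * h t" if t: "t \<in> {a<..<x}" for t
  proof -
    have p: "\<Psi> t > 0" "\<Psi> x > 0" "\<Psi> a > 0" using t pos by auto
    have g01: "0 < g t" "g t < 1" using image t by force+
    have der_eq: "deriv \<Psi> t = \<Psi>' t" using der[OF t] by (rule DERIV_imp_deriv)
    have Psi_pow: "complex_of_real (\<Psi> t / \<Psi> x) powr s * of_real (\<Psi> t) powr (- s) = of_real (\<Psi> x) powr (- s)"
      using p by (simp add: powr_def Ln_of_real ln_div flip: exp_add of_real_divide)
                 (simp add: algebra_simps)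
    have ln_pow: "complex_of_real (ln (\<Psi> t / \<Psi> a)) powr (\<nu> - 1) = of_real L powr (\<nu> - 1) * of_real (g t) powr (\<nu> - 1)"
    proof -
      have "ln (\<Psi> t / \<Psi> a) = L * g t" using L by (simp add: g_def)
      then show ?thesis unfolding \<open>ln _ = L * g t\<close> of_real_mult
        by (intro powr_times_real) (use L g01 in auto)
    qed
    have ln_pow': "complex_of_real (ln (\<Psi> x / \<Psi> t)) powr (\<mu> - 1) = of_real L powr (\<mu> - 1) * of_real (1 - g t) powr (\<mu> - 1)"
    proof -
      have "ln (\<Psi> x / \<Psi> t) = L * (1 - g t)" using L p by (simp add: g_def L_def ln_div field_simps)
      then show ?thesis unfolding \<open>ln _ = L * (1 - g t)\<close> of_real_mult
        by (intro powr_times_real) (use L g01 in auto)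
    qed
    have L_pow: "complex_of_real L powr (\<nu> + \<mu> - 1) = of_real L * (of_real L powr (\<nu> - 1) * of_real L powr (\<mu> - 1))"
    proof -
      have "complex_of_real L powr (\<nu> + \<mu> - 1) = of_real L powr (1 + ((\<nu> - 1) + (\<mu> - 1)))"
        by simp
      also have "\<dots> = of_real L * (of_real L powr (\<nu> - 1) * of_real L powr (\<mu> - 1))"
        unfolding powr_add using L by simp
      finally show ?thesis .
    qed
    have L_cancel: "of_real L * complex_of_real \<bar>\<Psi>' t / \<Psi> t / L\<bar> = of_real (\<Psi>' t / \<Psi> t)"
      using L p der_pos[OF t] by (simp add: abs_mult)
    have "of_real (\<Psi> t / \<Psi> x) powr s * of_real (ln (\<Psi> x / \<Psi> t)) powr (\<mu> - 1) *
        (of_real (\<Psi> t) powr (- s) * of_real (ln (\<Psi> t / \<Psi> a)) powr (\<nu> - 1)) * of_real (\<Psi>' t / \<Psi> t)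
      = (of_real (\<Psi> t / \<Psi> x) powr s * of_real (\<Psi> t) powr (- s)) * of_real (ln (\<Psi> x / \<Psi> t)) powr (\<mu> - 1) *
        of_real (ln (\<Psi> t / \<Psi> a)) powr (\<nu> - 1) * complex_of_real (\<Psi>' t / \<Psi> t)"
      by (simp only: mult_ac)
    also have "\<dots> = of_real (\<Psi> x) powr (- s) * of_real L powr (\<nu> + \<mu> - 1) * h t"
      unfolding Psi_pow ln_pow ln_pow' L_cancel[symmetric] L_pow h_def f_def scaleR_conv_of_real
      by (simp only: mult_ac)
    finally show ?thesis unfolding der_eq .
  qed
  \<comment> \<open>The change of variables holds for the completed measure. Passing to the Borel--Lebesgue measure
      requires Borel measurability of \<open>h\<close>, which comes from its continuity.\<close>
  have f_cont: "continuous_on {0<..<1} f"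
    unfolding f_def by (intro continuous_intros) (auto simp del: of_real_diff)
  have "continuous_on {a<..<x} (\<lambda>t. f (g t))"
    by (rule continuous_on_compose2[OF f_cont continuous_on_subset[OF g_cont]])
       (use image in auto)
  moreover have "\<Psi> t \<noteq> 0" if "t \<in> {a<..<x}" for t
    using pos[of t] that by auto
  ultimately have "continuous_on {a<..<x} h"
    unfolding h_def using L
    by (intro continuous_intros der_cont continuous_on_subset[OF cont])
      auto
  then have "(\<lambda>t. indicator {a<..<x} t *\<^sub>R h t) \<in> borel_measurable borel"
    by (intro borel_measurable_continuous_on_indicator) auto
  then have "set_integrable lborel {a<..<x} h"
    using subst unfolding set_integrable_def by (subst (asm) integrable_completion) auto
  then have h_val: "(LINT t:{a<..<x}|lborel. h t) = Beta \<nu> \<mu>"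
    using subst by (simp add: set_borel_integral_eq_integral(2))
  have "hadamard_integral \<Psi> a \<mu> s
           (\<lambda>t. of_real (\<Psi> t) powr (- s) * of_real (ln (\<Psi> t / \<Psi> a)) powr (\<nu> - 1)) x
      = rGamma \<mu> * (LINT t:{a<..<x}|lborel.
          of_real (\<Psi> x) powr (- s) * of_real L powr (\<nu> + \<mu> - 1) * h t)"
    unfolding hadamard_integral_def
    by (intro arg_cong[of _ _ "(*) _"] set_lebesgue_integral_cong) (use integrand in auto)
  also have "\<dots> = rGamma \<mu> * Beta \<nu> \<mu> * (of_real (\<Psi> x) powr (- s) * of_real L powr (\<nu> + \<mu> - 1))"
    by (simp add: h_val)
  also have "rGamma \<mu> * Beta \<nu> \<mu> = Gamma \<nu> * rGamma (\<nu> + \<mu>)"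
  proof -
    have "Gamma \<mu> \<noteq> 0"
      using \<mu> by (auto simp: Gamma_eq_zero_iff elim!: nonpos_Ints_cases)
    then show ?thesis by (simp add: Beta_altdef rGamma_inverse_Gamma)
  qed
  finally show ?thesis by (simp add: L_def mult_ac)
qed

section \<open>Iterated logarithmic derivatives\<close>

text \<open>
  \<open>Psi_log_deriv \<Psi>\<close> is differentiation with respect to \<open>u = ln (\<Psi> y / \<Psi> a)\<close>. With the
  normalisation by \<open>rGamma w\<close>, the factor \<open>w - 1\<close> produced by \<open>u powr (w - 1)\<close> is absorbed into
  \<open>rGamma (w - 1) = (w - 1) * rGamma w\<close>, so the form of the function is preserved for every
  complex \<open>w\<close>. The function \<open>g\<close> need only have this form on an open interval, since derivatives are
  local.
\<close>
lemma Psi_log_deriv_funpow: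
  fixes a b x :: real and w C :: complex
  assumes der: "\<And>t. t \<in> {a<..<b} \<Longrightarrow> (\<Psi> has_real_derivative \<Psi>' t) (at t)"
    and der_nz: "\<And>t. t \<in> {a<..<b} \<Longrightarrow> \<Psi>' t \<noteq> 0"
    and pos: "\<Psi> a > 0" and gt: "\<And>t. t \<in> {a<..<b} \<Longrightarrow> \<Psi> t > \<Psi> a"
    and g: "\<And>y. y \<in> {a<..<b} \<Longrightarrow> g y = C * rGamma w * of_real (ln (\<Psi> y / \<Psi> a)) powr (w - 1)"
    and x: "x \<in> {a<..<b}"
  shows "(Psi_log_deriv \<Psi> ^^ k) g x =
           C * rGamma (w - of_nat k) * of_real (ln (\<Psi> x / \<Psi> a)) powr (w - of_nat k - 1)"
  using x
proof (induction k arbitrary: x)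
  case 0
  then show ?case using g by simp
next
  case (Suc k)
  let ?z = "w - of_nat (Suc k)"
  let ?L = "\<lambda>y. ln (\<Psi> y / \<Psi> a)"
  have p: "\<Psi> x > 0" "\<Psi> x > \<Psi> a" using gt[OF Suc.prems] pos by auto
  have L: "?L x > 0" using p pos by (auto intro!: ln_gt_zero)
  have "((\<lambda>y. C * rGamma (?z + 1) * of_real (?L y) powr ?z) has_vector_derivative
      C * rGamma (?z + 1) * (of_real (\<Psi>' x / \<Psi> x) * (?z * of_real (?L x) powr (?z - 1)))) (at x)"
  proof (rule has_vector_derivative_mult_right)
    have "(?L has_real_derivative \<Psi>' x / \<Psi> x) (at x)"
      using p pos by (auto intro!: derivative_eq_intros der[OF Suc.prems] simp: divide_simps)
    then have "((\<lambda>y. complex_of_real (?L y)) has_vector_derivative of_real (\<Psi>' x / \<Psi> x)) (at x)"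
      by (intro has_vector_derivative_of_real) (simp add: has_real_derivative_iff_has_vector_derivative)
    moreover have "((\<lambda>u. u powr ?z) has_field_derivative ?z * of_real (?L x) powr (?z - 1)) (at (complex_of_real (?L x)))"
      by (rule has_field_derivative_powr) (use L in \<open>auto simp: complex_nonpos_Reals_iff\<close>)
    ultimately show "((\<lambda>y. of_real (?L y) powr ?z) has_vector_derivative
        of_real (\<Psi>' x / \<Psi> x) * (?z * of_real (?L x) powr (?z - 1))) (at x)"
      by (rule field_vector_diff_chain_at[of "\<lambda>y. complex_of_real (?L y)" _ x "\<lambda>u. u powr ?z",
            unfolded o_def])
  qed
  then have "((Psi_log_deriv \<Psi> ^^ k) g has_vector_derivative
      C * rGamma (?z + 1) * (of_real (\<Psi>' x / \<Psi> x) * (?z * of_real (?L x) powr (?z - 1)))) (at x)"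
    by (rule has_vector_derivative_transform_within_open[where S = "{a<..<b}"])
       (use Suc in \<open>auto simp: algebra_simps\<close>)
  then have "vector_derivative ((Psi_log_deriv \<Psi> ^^ k) g) (at x) =
      C * rGamma (?z + 1) * (of_real (\<Psi>' x / \<Psi> x) * (?z * of_real (?L x) powr (?z - 1)))"
    by (rule vector_derivative_at)
  then have "(Psi_log_deriv \<Psi> ^^ Suc k) g x = of_real (\<Psi> x / \<Psi>' x) *
      (C * rGamma (?z + 1) * (of_real (\<Psi>' x / \<Psi> x) * (?z * of_real (?L x) powr (?z - 1))))"
    by (simp only: funpow.simps o_apply Psi_log_deriv_def DERIV_imp_deriv[OF der[OF Suc.prems]])
  also have "\<dots> = (of_real (\<Psi> x / \<Psi>' x) * of_real (\<Psi>' x / \<Psi> x)) *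
      (C * (?z * rGamma (?z + 1)) * of_real (?L x) powr (?z - 1))"
    by (simp only: mult_ac)
  also have "of_real (\<Psi> x / \<Psi>' x) * of_real (\<Psi>' x / \<Psi> x) = (1 :: complex)"
    using p der_nz[OF Suc.prems] by (simp flip: of_real_mult)
  finally show ?case by (simp only: rGamma_plus1 mult_1)
qed

section \<open>Arbitrary complex order\<close>

theorem proposition3p13:
  fixes a b \<nu> x :: real and \<Psi> \<Psi>' :: "real \<Rightarrow> real" and \<mu> s :: complex
  assumes "a < b"
    and "\<And>t. t \<in> {a..b} \<Longrightarrow> (\<Psi> has_real_derivative \<Psi>' t) (at t within {a..b})"
    and "continuous_on {a..b} \<Psi>'"
    and "\<And>t. t \<in> {a..b} \<Longrightarrow> \<Psi> t > 0"
    and "mono_on {a..b} \<Psi>"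
    and "\<And>t. t \<in> {a..b} \<Longrightarrow> \<Psi>' t \<noteq> 0"
    and "\<nu> > 0"
    and "x \<in> {a<..<b}"
  shows "hadamard_I \<Psi> a \<mu> s
           (\<lambda>t. of_real (\<Psi> t) powr (- s) * of_real (ln (\<Psi> t / \<Psi> a)) powr (of_real \<nu> - 1)) x
         = Gamma (of_real \<nu>) * rGamma (of_real \<nu> + \<mu>) *
           of_real (\<Psi> x) powr (- s) * of_real (ln (\<Psi> x / \<Psi> a)) powr (of_real \<nu> + \<mu> - 1)
       \<and> hadamard_D \<Psi> a \<mu> s
           (\<lambda>t. of_real (\<Psi> t) powr (- s) * of_real (ln (\<Psi> t / \<Psi> a)) powr (of_real \<nu> - 1)) x
         = Gamma (of_real \<nu>) * rGamma (of_real \<nu> - \<mu>) *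
           of_real (\<Psi> x) powr (- s) * of_real (ln (\<Psi> x / \<Psi> a)) powr (of_real \<nu> - \<mu> - 1)"
proof -
  note x = \<open>x \<in> {a<..<b}\<close>
  have der: "(\<Psi> has_real_derivative \<Psi>' t) (at t)" if "t \<in> {a<..<b}" for t
    using assms(2)[of t] that by (simp add: at_within_Icc_at)
  have cont: "continuous_on {a..b} \<Psi>"
    using assms(2) by (rule DERIV_continuous_on)
  have der_pos: "\<Psi>' t > 0" if "t \<in> {a<..<b}" for t
    using mono_on_imp_deriv_nonneg[OF assms(5) der[OF that]] assms(6)[of t] that
    by (simp add: less_le)
  have gt: "\<Psi> t > \<Psi> a" if "t \<in> {a<..<b}" for t
    by (rule DERIV_pos_imp_increasing_open)
       (use that der der_pos in \<open>force intro: continuous_on_subset[OF cont]\<close>)+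
  define f where "f t = complex_of_real (\<Psi> t) powr (- s) *
                          of_real (ln (\<Psi> t / \<Psi> a)) powr (of_real \<nu> - 1)" for t
  \<comment> \<open>Needed at all points of \<open>(a, b)\<close> and not only at \<open>x\<close>, because the result is differentiated below.\<close>
  have I: "hadamard_integral \<Psi> a \<alpha> s f y = Gamma (of_real \<nu>) * rGamma (of_real \<nu> + \<alpha>) *
      of_real (\<Psi> y) powr (- s) * of_real (ln (\<Psi> y / \<Psi> a)) powr (of_real \<nu> + \<alpha> - 1)"
    if "Re \<alpha> > 0" "y \<in> {a<..<b}" for \<alpha> y
    unfolding f_def
    by (rule hadamard_integral_log_power[where \<Psi>' = \<Psi>'])
       (use that assms(4,7) der der_pos in
         \<open>auto intro: continuous_on_subset[OF cont] continuous_on_subset[OF assms(3)]\<close>)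
  have D: "hadamard_RL_deriv \<Psi> a \<alpha> s f x = Gamma (of_real \<nu>) * rGamma (of_real \<nu> - \<alpha>) *
      of_real (\<Psi> x) powr (- s) * of_real (ln (\<Psi> x / \<Psi> a)) powr (of_real \<nu> - \<alpha> - 1)"
    if \<alpha>: "Re \<alpha> \<ge> 0" for \<alpha>
  proof -
    define n where "n = nat \<lfloor>Re \<alpha>\<rfloor> + 1"
    have "real n = of_int \<lfloor>Re \<alpha>\<rfloor> + 1"
      using \<alpha> by (simp add: n_def)
    then have n: "Re (of_nat n - \<alpha>) > 0"
      by simp
    define w where "w = of_real \<nu> + (of_nat n - \<alpha>)"
    have "(Psi_log_deriv \<Psi> ^^ n)
        (\<lambda>y. of_real (\<Psi> y) powr s * hadamard_integral \<Psi> a (of_nat n - \<alpha>) s f y) x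
      = Gamma (of_real \<nu>) * rGamma (w - of_nat n) *
          of_real (ln (\<Psi> x / \<Psi> a)) powr (w - of_nat n - 1)"
    proof (rule Psi_log_deriv_funpow[OF der _ _ gt _ x])
      fix y assume y: "y \<in> {a<..<b}"
      then have "\<Psi> y > 0" using assms(4) by auto
      then have "complex_of_real (\<Psi> y) powr s * of_real (\<Psi> y) powr (- s) = 1"
        by (simp flip: powr_add)
      then show "of_real (\<Psi> y) powr s * hadamard_integral \<Psi> a (of_nat n - \<alpha>) s f y
          = Gamma (of_real \<nu>) * rGamma w * of_real (ln (\<Psi> y / \<Psi> a)) powr (w - 1)"
        unfolding I[OF n y] w_def by (simp add: mult_ac)
    qed (use assms(1,4,6) in auto)
    moreover have "w - of_nat n = of_real \<nu> - \<alpha>"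
      by (simp add: w_def)
    ultimately show ?thesis
      unfolding hadamard_RL_deriv_def Let_def hadamard_deriv_nat_def n_def[symmetric]
      by (simp add: mult_ac)
  qed
  have "hadamard_I \<Psi> a \<mu> s f x = Gamma (of_real \<nu>) * rGamma (of_real \<nu> + \<mu>) *
      of_real (\<Psi> x) powr (- s) * of_real (ln (\<Psi> x / \<Psi> a)) powr (of_real \<nu> + \<mu> - 1)"
    using I[OF _ x, of \<mu>] D[of "- \<mu>"] by (simp add: hadamard_I_def)
  moreover have "hadamard_D \<Psi> a \<mu> s f x = Gamma (of_real \<nu>) * rGamma (of_real \<nu> - \<mu>) *
      of_real (\<Psi> x) powr (- s) * of_real (ln (\<Psi> x / \<Psi> a)) powr (of_real \<nu> - \<mu> - 1)"
    using I[OF _ x, of "- \<mu>"] D[of \<mu>] by (simp add: hadamard_D_def)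
  ultimately show ?thesis
    unfolding f_def by blast
qed

end
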